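(* A fuzzy soft topological space $(X,\tau)$ is fuzzy soft $q$-$T_1$ if and only if each fuzzy soft point $(e_1)_x^\alpha\in FS(X,E)$ is a fuzzy soft closed set.
   Context: $X$ is a nonempty universe and $E$ a set of parameters. $I^X$ is the set of functions $X\to[0,1]$ (fuzzy sets); $0_X,1_X$ are the constant functions. A fuzzy soft set over $X$ is a map $f_A:E\to I^X$, where $A\subseteq E$, $f_A(e)\ne 0_X$ if $e\in A$ and $f_A(e)=0_X$ if $e\notin A$; $FS(X,E)$ is the family of all of them. $\widetilde 0_E$ and $\widetilde 1_E$ are the fuzzy soft sets with value $0_X$, respectively $1_X$, at every $e\in E$. Write $f_A\sqsubseteq g_B$ if $f_A(e)\le g_B(e)$ pointwise for all $e\in E$; $\sqcup$ and $\sqcap$ are the pointwise supremum and infimum; the complement is $f_A^c(e)=1-f_A(e)$. A fuzzy soft topological space $(X,\tau)$ consists of $X$ and a family $\tau\subseteq FS(X,E)$ containing $\widetilde 0_E,\widetilde 1_E$ and closed under binary $\sqcap$ and arbitrary $\sqcup$. Members of $\tau$ are called fuzzy soft open; $g_B$ is fuzzy soft closed if $g_B^c\in\tau$. A fuzzy soft point $e_x^\alpha$ ($e\in E$, $x\in X$, $0<\alpha\le 1$) is the fuzzy soft set with value $\alpha$ at $(e,x)$ and $0$ at every other pair. $f_A\,q\,g_B$ (soft quasi-coincident) means that there are $e\in E$, $x\in X$ with $f_A(e)(x)+g_B(e)(x)>1$; $f_A\,\overline q\,g_B$ is the negation. $N(f_A)$ denotes the set of fuzzy soft neighborhoods of $f_A$: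 those $g_B$ for which some open $h_C$ satisfies $f_A\sqsubseteq h_C\sqsubseteq g_B$. $N_q(f_A)$ denotes the set of Q-neighborhoods of $f_A$: those $g_B$ for which some open $h_C$ satisfies $f_A\,q\,h_C$ and $h_C\sqsubseteq g_B$. $(X,\tau)$ is fuzzy soft $q$-$T_1$ if for all distinct fuzzy soft points $(e_1)_x^\alpha,(e_2)_y^\beta$: (a) when $e_1\neq e_2$ or $x\ne y$, there are fuzzy soft open $f_A\in N((e_1)_x^\alpha)$ with $f_A\,\overline q\,(e_2)_y^\beta$ and fuzzy soft open $g_B\in N((e_2)_y^\beta)$ with $g_B\,\overline q\,(e_1)_x^\alpha$; (b) when $e_1=e_2$, $x=y$ and (say) $\alpha<\beta$, there is a fuzzy soft open $f_A\in N_q((e_2)_y^\beta)$ with $(e_1)_x^\alpha\,\overline q\,f_A$. *)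

theory Defs
  imports Complex_Main "HOL-Library.FuncSet"
begin

text \<open>
  The universe \<open>X\<close> and the parameter set \<open>E\<close> are explicit carriers. Maps on them are
  represented extensionally (value \<open>undefined\<close> outside the carrier), so that HOL equality
  of fuzzy soft sets is equality of maps on \<open>E\<close> and \<open>X\<close>.
\<close>

type_synonym ('e, 'x) fuzzy_soft = "'e \<Rightarrow> 'x \<Rightarrow> real"

definition fuzzy_sets :: "'x set \<Rightarrow> ('x \<Rightarrow> real) set" where
  "fuzzy_sets X = X \<rightarrow>\<^sub>E {0..1}"

definition const_fuzzy :: "'x set \<Rightarrow> real \<Rightarrow> 'x \<Rightarrow> real" where
  "const_fuzzy X c = (\<lambda>x\<in>X. c)"

definition fuzzy_soft_set_on ::
    "'x set \<Rightarrow> 'e set \<Rightarrow> 'e set \<Rightarrow> ('e, 'x) fuzzy_soft \<Rightarrow> bool" where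
  "fuzzy_soft_set_on X E A f \<longleftrightarrow>
     A \<subseteq> E \<and> f \<in> E \<rightarrow>\<^sub>E fuzzy_sets X \<and>
     (\<forall>e\<in>E. (e \<in> A \<longrightarrow> f e \<noteq> const_fuzzy X 0) \<and> (e \<notin> A \<longrightarrow> f e = const_fuzzy X 0))"

text \<open>The index \<open>A\<close> of a fuzzy soft set is determined by the map, so only the map is kept.\<close>

definition FS :: "'x set \<Rightarrow> 'e set \<Rightarrow> ('e, 'x) fuzzy_soft set" where
  "FS X E = {f. \<exists>A. fuzzy_soft_set_on X E A f}"

lemma FS_eq_PiE: "FS X E = E \<rightarrow>\<^sub>E fuzzy_sets X"
proof
  show "E \<rightarrow>\<^sub>E fuzzy_sets X \<subseteq> FS X E"
  proof
    fix f assume "f \<in> E \<rightarrow>\<^sub>E fuzzy_sets X"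
    then have "fuzzy_soft_set_on X E {e \<in> E. f e \<noteq> const_fuzzy X 0} f"
      by (auto simp: fuzzy_soft_set_on_def)
    then show "f \<in> FS X E" by (auto simp: FS_def)
  qed
qed (auto simp: FS_def fuzzy_soft_set_on_def)

definition fs_zero :: "'x set \<Rightarrow> 'e set \<Rightarrow> ('e, 'x) fuzzy_soft" where
  "fs_zero X E = (\<lambda>e\<in>E. const_fuzzy X 0)"

definition fs_one :: "'x set \<Rightarrow> 'e set \<Rightarrow> ('e, 'x) fuzzy_soft" where
  "fs_one X E = (\<lambda>e\<in>E. const_fuzzy X 1)"

definition fs_le ::
    "'x set \<Rightarrow> 'e set \<Rightarrow> ('e, 'x) fuzzy_soft \<Rightarrow> ('e, 'x) fuzzy_soft \<Rightarrow> bool" where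
  "fs_le X E f g \<longleftrightarrow> (\<forall>e\<in>E. \<forall>x\<in>X. f e x \<le> g e x)"

definition fs_inf ::
    "'x set \<Rightarrow> 'e set \<Rightarrow> ('e, 'x) fuzzy_soft \<Rightarrow> ('e, 'x) fuzzy_soft \<Rightarrow> ('e, 'x) fuzzy_soft" where
  "fs_inf X E f g = (\<lambda>e\<in>E. \<lambda>x\<in>X. min (f e x) (g e x))"

text \<open>
  Suprema are taken in \<open>[0,1]\<close>: inserting \<open>0\<close> changes nothing for a nonempty family and gives
  the empty family its supremum \<open>0\<close>, where \<open>Sup {}\<close> on the reals would be arbitrary.
\<close>

definition fs_Sup ::
    "'x set \<Rightarrow> 'e set \<Rightarrow> ('e, 'x) fuzzy_soft set \<Rightarrow> ('e, 'x) fuzzy_soft" where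
  "fs_Sup X E F = (\<lambda>e\<in>E. \<lambda>x\<in>X. Sup (insert 0 ((\<lambda>f. f e x) ` F)))"

definition fs_compl :: "'x set \<Rightarrow> 'e set \<Rightarrow> ('e, 'x) fuzzy_soft \<Rightarrow> ('e, 'x) fuzzy_soft" where
  "fs_compl X E f = (\<lambda>e\<in>E. \<lambda>x\<in>X. 1 - f e x)"

definition fuzzy_soft_topological_space ::
    "'x set \<Rightarrow> 'e set \<Rightarrow> ('e, 'x) fuzzy_soft set \<Rightarrow> bool" where
  "fuzzy_soft_topological_space X E \<tau> \<longleftrightarrow>
     X \<noteq> {} \<and> \<tau> \<subseteq> FS X E \<and>
     fs_zero X E \<in> \<tau> \<and> fs_one X E \<in> \<tau> \<and>
     (\<forall>f\<in>\<tau>. \<forall>g\<in>\<tau>. fs_inf X E f g \<in> \<tau>) \<and>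
     (\<forall>F. F \<subseteq> \<tau> \<longrightarrow> fs_Sup X E F \<in> \<tau>)"

definition fs_closed ::
    "'x set \<Rightarrow> 'e set \<Rightarrow> ('e, 'x) fuzzy_soft set \<Rightarrow> ('e, 'x) fuzzy_soft \<Rightarrow> bool" where
  "fs_closed X E \<tau> g \<longleftrightarrow> g \<in> FS X E \<and> fs_compl X E g \<in> \<tau>"

definition fs_point :: "'x set \<Rightarrow> 'e set \<Rightarrow> 'e \<Rightarrow> 'x \<Rightarrow> real \<Rightarrow> ('e, 'x) fuzzy_soft" where
  "fs_point X E e x \<alpha> = (\<lambda>e'\<in>E. \<lambda>x'\<in>X. if e' = e \<and> x' = x then \<alpha> else 0)"

definition quasi_coincident ::
    "'x set \<Rightarrow> 'e set \<Rightarrow> ('e, 'x) fuzzy_soft \<Rightarrow> ('e, 'x) fuzzy_soft \<Rightarrow> bool" where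
  "quasi_coincident X E f g \<longleftrightarrow> (\<exists>e\<in>E. \<exists>x\<in>X. f e x + g e x > 1)"

definition fs_nbhds ::
    "'x set \<Rightarrow> 'e set \<Rightarrow> ('e, 'x) fuzzy_soft set \<Rightarrow> ('e, 'x) fuzzy_soft \<Rightarrow> ('e, 'x) fuzzy_soft set" where
  "fs_nbhds X E \<tau> f = {g \<in> FS X E. \<exists>h\<in>\<tau>. fs_le X E f h \<and> fs_le X E h g}"

definition fs_Q_nbhds ::
    "'x set \<Rightarrow> 'e set \<Rightarrow> ('e, 'x) fuzzy_soft set \<Rightarrow> ('e, 'x) fuzzy_soft \<Rightarrow> ('e, 'x) fuzzy_soft set" where
  "fs_Q_nbhds X E \<tau> f = {g \<in> FS X E. \<exists>h\<in>\<tau>. quasi_coincident X E f h \<and> fs_le X E h g}"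

text \<open>
  In the second clause the case \<open>\<beta> < \<alpha>\<close> needs no separate mention, since all ordered pairs of
  points are considered.
\<close>

definition fs_q_T1 :: "'x set \<Rightarrow> 'e set \<Rightarrow> ('e, 'x) fuzzy_soft set \<Rightarrow> bool" where
  "fs_q_T1 X E \<tau> \<longleftrightarrow>
     (\<forall>e1\<in>E. \<forall>e2\<in>E. \<forall>x\<in>X. \<forall>y\<in>X. \<forall>\<alpha>\<in>{0<..1}. \<forall>\<beta>\<in>{0<..1}.
        fs_point X E e1 x \<alpha> \<noteq> fs_point X E e2 y \<beta> \<longrightarrow>
        (e1 \<noteq> e2 \<or> x \<noteq> y \<longrightarrow>
           (\<exists>f\<in>\<tau>. f \<in> fs_nbhds X E \<tau> (fs_point X E e1 x \<alpha>) \<and>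
                  \<not> quasi_coincident X E f (fs_point X E e2 y \<beta>)) \<and>
           (\<exists>g\<in>\<tau>. g \<in> fs_nbhds X E \<tau> (fs_point X E e2 y \<beta>) \<and>
                  \<not> quasi_coincident X E g (fs_point X E e1 x \<alpha>))) \<and>
        (e1 = e2 \<and> x = y \<and> \<alpha> < \<beta> \<longrightarrow>
           (\<exists>f\<in>\<tau>. f \<in> fs_Q_nbhds X E \<tau> (fs_point X E e2 y \<beta>) \<and>
                  \<not> quasi_coincident X E (fs_point X E e1 x \<alpha>) f)))"

end

theory Submission
  imports Defs
begin

text \<open>
  A fuzzy soft set fails to be quasi-coincident with a point \<open>p\<close> exactly when it lies below the
  complement of \<open>p\<close>. The separation axiom therefore only speaks of open sets below complements of
  points. If points are closed, these complements are themselves open and are the required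
  separating sets.

  Conversely, the complement of \<open>p = e\<^sub>x\<^sup>\<alpha>\<close> is open once it is the supremum of the open sets below
  it, and this can be checked one coordinate at a time (lemma \<open>open_if_approximated_by_open\<close>). At a
  coordinate other than \<open>(e, x)\<close> the complement has value \<open>1\<close>, which is attained by a neighbourhood of
  the point of height \<open>1\<close> there. At \<open>(e, x)\<close> it has value \<open>1 - \<alpha>\<close>, and every \<open>0 \<le> r < 1 - \<alpha>\<close> is
  exceeded by a Q-neighbourhood of the point \<open>e\<^sub>x\<^sup>\<beta>\<close> with \<open>\<beta> = 1 - r > \<alpha>\<close>. The value
  \<open>1 - \<alpha>\<close> itself need not be attained by any single one of these open sets, only by their supremum.
\<close>

lemma fs_point_apply [simp]:
  assumes "e' \<in> E" "x' \<in> X"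
  shows "fs_point X E e x \<alpha> e' x' = (if e' = e \<and> x' = x then \<alpha> else 0)"
  using assms by (simp add: fs_point_def)

lemma fs_compl_apply [simp]:
  assumes "e \<in> E" "x \<in> X"
  shows "fs_compl X E f e x = 1 - f e x"
  using assms by (simp add: fs_compl_def)

lemma FS_bounds:
  assumes "f \<in> FS X E" "e \<in> E" "x \<in> X"
  shows "0 \<le> f e x" "f e x \<le> 1"
proof -
  have "f e \<in> X \<rightarrow>\<^sub>E {0..1}"
    using assms by (auto simp: FS_eq_PiE fuzzy_sets_def)
  then have "f e x \<in> {0..1}"
    using assms by blast
  then show "0 \<le> f e x" "f e x \<le> 1" by auto
qed

lemma FS_eqI:
  assumes "f \<in> FS X E" "g \<in> FS X E"
    and "\<And>e x. e \<in> E \<Longrightarrow> x \<in> X \<Longrightarrow> f e x = g e x"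
  shows "f = g"
proof (rule PiE_ext)
  show "f \<in> E \<rightarrow>\<^sub>E fuzzy_sets X" "g \<in> E \<rightarrow>\<^sub>E fuzzy_sets X"
    using assms by (auto simp: FS_eq_PiE)
  fix e assume "e \<in> E"
  show "f e = g e"
  proof (rule PiE_ext)
    show "f e \<in> X \<rightarrow>\<^sub>E {0..1}" "g e \<in> X \<rightarrow>\<^sub>E {0..1}"
      using assms \<open>e \<in> E\<close> by (auto simp: FS_eq_PiE fuzzy_sets_def)
  qed (use assms \<open>e \<in> E\<close> in auto)
qed

lemma fs_point_in_FS:
  assumes "\<alpha> \<in> {0<..1}"
  shows "fs_point X E e x \<alpha> \<in> FS X E"
  using assms by (auto simp: FS_eq_PiE fuzzy_sets_def fs_point_def)

lemma fs_compl_in_FS: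
  assumes "f \<in> FS X E"
  shows "fs_compl X E f \<in> FS X E"
  using FS_bounds[OF assms] by (auto simp: FS_eq_PiE fuzzy_sets_def fs_compl_def)

lemma fs_point_eq_iff:
  assumes "e1 \<in> E" "x \<in> X" "\<alpha> > 0"
  shows "fs_point X E e1 x \<alpha> = fs_point X E e2 y \<beta> \<longleftrightarrow> e1 = e2 \<and> x = y \<and> \<alpha> = \<beta>"
proof
  assume "fs_point X E e1 x \<alpha> = fs_point X E e2 y \<beta>"
  then have "fs_point X E e1 x \<alpha> e1 x = fs_point X E e2 y \<beta> e1 x" by simp
  then show "e1 = e2 \<and> x = y \<and> \<alpha> = \<beta>"
    using assms by (simp split: if_splits)
qed simp

lemma fs_le_refl: "fs_le X E f f"
  by (simp add: fs_le_def)

lemma fs_le_trans: "fs_le X E f g \<Longrightarrow> fs_le X E g h \<Longrightarrow> fs_le X E f h"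
  unfolding fs_le_def by (meson order_trans)

lemma quasi_coincident_mono:
  "quasi_coincident X E f g \<Longrightarrow> fs_le X E g h \<Longrightarrow> quasi_coincident X E f h"
  unfolding quasi_coincident_def fs_le_def by (meson add_left_mono less_le_trans)

lemma quasi_coincident_commute:
  "quasi_coincident X E f g \<longleftrightarrow> quasi_coincident X E g f"
  by (simp add: quasi_coincident_def add.commute)

lemma not_quasi_coincident_iff_le_compl:
  "\<not> quasi_coincident X E f g \<longleftrightarrow> fs_le X E f (fs_compl X E g)"
  by (auto simp: quasi_coincident_def fs_le_def not_less le_diff_eq)

lemma fs_point_quasi_coincident_iff:
  assumes "e \<in> E" "x \<in> X" "h \<in> FS X E"
  shows "quasi_coincident X E (fs_point X E e x \<alpha>) h \<longleftrightarrow> \<alpha> + h e x > 1"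
proof
  assume "quasi_coincident X E (fs_point X E e x \<alpha>) h"
  then obtain e' x' where "e' \<in> E" "x' \<in> X" "fs_point X E e x \<alpha> e' x' + h e' x' > 1"
    by (auto simp: quasi_coincident_def)
  \<comment> \<open>Away from \<open>(e, x)\<close> the point contributes \<open>0\<close>, and \<open>h\<close> alone never exceeds \<open>1\<close>.\<close>
  then show "\<alpha> + h e x > 1"
    using FS_bounds(2)[OF assms(3), of e' x'] by (auto split: if_splits)
qed (use assms in \<open>auto simp: quasi_coincident_def intro!: bexI[of _ e] bexI[of _ x]\<close>)

lemma fs_point_le_iff:
  assumes "e \<in> E" "x \<in> X" "h \<in> FS X E"
  shows "fs_le X E (fs_point X E e x \<alpha>) h \<longleftrightarrow> \<alpha> \<le> h e x"
  using assms FS_bounds(1)[OF assms(3)] by (auto simp: fs_le_def)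

text \<open>
  For an open set, the auxiliary open set in the definition of a (Q-)neighbourhood can be taken to be
  the set itself.
\<close>

lemma open_in_fs_nbhds_point_iff:
  assumes "\<tau> \<subseteq> FS X E" "f \<in> \<tau>" "e \<in> E" "x \<in> X"
  shows "f \<in> fs_nbhds X E \<tau> (fs_point X E e x \<alpha>) \<longleftrightarrow> \<alpha> \<le> f e x"
proof -
  have "f \<in> fs_nbhds X E \<tau> (fs_point X E e x \<alpha>) \<longleftrightarrow> fs_le X E (fs_point X E e x \<alpha>) f"
    using assms by (auto simp: fs_nbhds_def fs_le_refl intro: fs_le_trans)
  also have "\<dots> \<longleftrightarrow> \<alpha> \<le> f e x"
    using assms by (intro fs_point_le_iff) auto
  finally show ?thesis .
qed

lemma open_in_fs_Q_nbhds_point_iff: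
  assumes "\<tau> \<subseteq> FS X E" "f \<in> \<tau>" "e \<in> E" "x \<in> X"
  shows "f \<in> fs_Q_nbhds X E \<tau> (fs_point X E e x \<alpha>) \<longleftrightarrow> \<alpha> + f e x > 1"
proof -
  have "f \<in> fs_Q_nbhds X E \<tau> (fs_point X E e x \<alpha>) \<longleftrightarrow>
        quasi_coincident X E (fs_point X E e x \<alpha>) f"
    using assms by (auto simp: fs_Q_nbhds_def fs_le_refl intro: quasi_coincident_mono)
  also have "\<dots> \<longleftrightarrow> \<alpha> + f e x > 1"
    using assms by (intro fs_point_quasi_coincident_iff) auto
  finally show ?thesis .
qed

text \<open>
  The fuzzy analogue of the fact that a set is open if each of its points has an open
  neighbourhood inside it: \<open>g\<close> is the supremum of the open sets below it. The restriction to
  \<open>r \<ge> 0\<close> makes the condition vacuous at coordinates where \<open>g\<close> vanishes.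
\<close>

lemma open_if_approximated_by_open:
  assumes space: "fuzzy_soft_topological_space X E \<tau>"
    and g: "g \<in> FS X E"
    and approx: "\<And>e x r. \<lbrakk>e \<in> E; x \<in> X; 0 \<le> r; r < g e x\<rbrakk> \<Longrightarrow>
      \<exists>f\<in>\<tau>. fs_le X E f g \<and> r < f e x"
  shows "g \<in> \<tau>"
proof -
  define F where "F = {f \<in> \<tau>. fs_le X E f g}"
  have open_Sup: "fs_Sup X E F \<in> \<tau>"
    using space by (auto simp: fuzzy_soft_topological_space_def F_def)
  have "fs_Sup X E F = g"
  proof (rule FS_eqI)
    show "fs_Sup X E F \<in> FS X E"
      using open_Sup space by (auto simp: fuzzy_soft_topological_space_def)
    fix e x assume ex: "e \<in> E" "x \<in> X"
    let ?V = "insert 0 ((\<lambda>f. f e x) ` F)"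
    have g_nonneg: "0 \<le> g e x"
      using FS_bounds[OF g ex] by simp
    have V_le: "v \<le> g e x" if "v \<in> ?V" for v
      using that g_nonneg ex by (auto simp: F_def fs_le_def)
    have "Sup ?V = g e x"
    proof (rule cSup_eq_non_empty)
      fix u assume u: "\<And>v. v \<in> ?V \<Longrightarrow> v \<le> u"
      then have "0 \<le> u" by simp
      show "g e x \<le> u"
      proof (rule ccontr)
        assume "\<not> g e x \<le> u"
        then obtain f where "f \<in> \<tau>" "fs_le X E f g" "u < f e x"
          using approx[OF ex \<open>0 \<le> u\<close>] by auto
        then show False
          using u[of "f e x"] by (auto simp: F_def)
      qed
    qed (use V_le in auto)
    then show "fs_Sup X E F e x = g e x"
      using ex by (simp add: fs_Sup_def)
  qed (rule g)
  with open_Sup show ?thesis by simp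
qed

lemma fs_q_T1_imp_point_closed:
  assumes space: "fuzzy_soft_topological_space X E \<tau>"
    and T1: "fs_q_T1 X E \<tau>"
    and e: "e \<in> E" and x: "x \<in> X" and \<alpha>: "\<alpha> \<in> {0<..1}"
  shows "fs_closed X E \<tau> (fs_point X E e x \<alpha>)"
proof -
  let ?p = "fs_point X E e x \<alpha>"
  have \<tau>: "\<tau> \<subseteq> FS X E"
    using space by (simp add: fuzzy_soft_topological_space_def)
  have "fs_compl X E ?p \<in> \<tau>"
  proof (rule open_if_approximated_by_open[OF space])
    show "fs_compl X E ?p \<in> FS X E"
      by (intro fs_compl_in_FS fs_point_in_FS \<alpha>)
    fix e' x' r
    assume e': "e' \<in> E" and x': "x' \<in> X" and "0 \<le> r"
      and r: "r < fs_compl X E ?p e' x'"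
    show "\<exists>f\<in>\<tau>. fs_le X E f (fs_compl X E ?p) \<and> r < f e' x'"
    proof (cases "e' = e \<and> x' = x")
      case True
      define \<beta> where "\<beta> = 1 - r"
      have \<beta>: "\<beta> \<in> {0<..1}" "\<alpha> < \<beta>"
        using True r \<open>0 \<le> r\<close> \<alpha> e x by (auto simp: \<beta>_def)
      have "?p \<noteq> fs_point X E e x \<beta>"
        using fs_point_eq_iff[OF e x, of \<alpha>] \<alpha> \<beta> by auto
      then obtain f where "f \<in> \<tau>" "f \<in> fs_Q_nbhds X E \<tau> (fs_point X E e x \<beta>)"
          "\<not> quasi_coincident X E ?p f"
        using T1 e x \<alpha> \<beta> unfolding fs_q_T1_def by blast
      then show ?thesis
        using open_in_fs_Q_nbhds_point_iff[OF \<tau> _ e x] True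
        by (auto simp: \<beta>_def quasi_coincident_commute[of X E ?p]
              not_quasi_coincident_iff_le_compl)
    next
      case False
      have "?p \<noteq> fs_point X E e' x' 1"
        using fs_point_eq_iff[OF e x, of \<alpha>] \<alpha> False by auto
      moreover have "(1::real) \<in> {0<..1}" by simp
      ultimately obtain f where "f \<in> \<tau>" "f \<in> fs_nbhds X E \<tau> (fs_point X E e' x' 1)"
          "\<not> quasi_coincident X E f ?p"
        using T1 e x e' x' \<alpha> False unfolding fs_q_T1_def by blast
      then show ?thesis
        using open_in_fs_nbhds_point_iff[OF \<tau> _ e' x'] False r e' x'
        by (auto simp: not_quasi_coincident_iff_le_compl)
    qed
  qed
  then show ?thesis
    using fs_point_in_FS[OF \<alpha>] by (simp add: fs_closed_def)
qed

lemma points_closed_imp_fs_q_T1: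
  assumes \<tau>: "\<tau> \<subseteq> FS X E"
    and closed: "\<And>e x \<alpha>. \<lbrakk>e \<in> E; x \<in> X; \<alpha> \<in> {0<..1}\<rbrakk> \<Longrightarrow>
      fs_closed X E \<tau> (fs_point X E e x \<alpha>)"
  shows "fs_q_T1 X E \<tau>"
proof -
  let ?c = "\<lambda>e x \<alpha>. fs_compl X E (fs_point X E e x \<alpha>)"
  have open_c: "?c e x \<alpha> \<in> \<tau>" if "e \<in> E" "x \<in> X" "\<alpha> \<in> {0<..1}" for e x \<alpha>
    using closed[OF that] by (simp add: fs_closed_def)
  have c_not_q: "\<not> quasi_coincident X E (?c e x \<alpha>) (fs_point X E e x \<alpha>)" for e x \<alpha>
    by (simp add: not_quasi_coincident_iff_le_compl fs_le_def)
  have separate: "\<exists>f\<in>\<tau>. f \<in> fs_nbhds X E \<tau> (fs_point X E e1 x \<alpha>) \<and>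
      \<not> quasi_coincident X E f (fs_point X E e2 y \<beta>)"
    if "e1 \<in> E" "e2 \<in> E" "x \<in> X" "y \<in> X" "\<alpha> \<in> {0<..1}" "\<beta> \<in> {0<..1}" "e1 \<noteq> e2 \<or> x \<noteq> y"
    for e1 e2 x y \<alpha> \<beta>
    using that open_c[of e2 y \<beta>] c_not_q[of e2 y \<beta>]
    by (intro bexI[of _ "?c e2 y \<beta>"])
      (auto simp: open_in_fs_nbhds_point_iff[OF \<tau>])
  have separate_heights: "\<exists>f\<in>\<tau>. f \<in> fs_Q_nbhds X E \<tau> (fs_point X E e x \<beta>) \<and>
      \<not> quasi_coincident X E (fs_point X E e x \<alpha>) f"
    if "e \<in> E" "x \<in> X" "\<alpha> \<in> {0<..1}" "\<alpha> < \<beta>" for e x \<alpha> \<beta>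
    using that open_c[of e x \<alpha>] c_not_q[of e x \<alpha>]
    by (intro bexI[of _ "?c e x \<alpha>"])
      (auto simp: open_in_fs_Q_nbhds_point_iff[OF \<tau>]
        quasi_coincident_commute[of X E "fs_point X E e x \<alpha>"])
  show ?thesis
    unfolding fs_q_T1_def
  proof (intro ballI impI conjI; (elim conjE)?)
  qed (auto intro: separate separate_heights)
qed

theorem theorem9:
  fixes X :: "'x set" and E :: "'e set" and \<tau> :: "('e, 'x) fuzzy_soft set"
  assumes "fuzzy_soft_topological_space X E \<tau>"
  shows "fs_q_T1 X E \<tau> \<longleftrightarrow>
         (\<forall>e\<in>E. \<forall>x\<in>X. \<forall>\<alpha>\<in>{0<..1}. fs_closed X E \<tau> (fs_point X E e x \<alpha>))"
proof
  show "\<forall>e\<in>E. \<forall>x\<in>X. \<forall>\<alpha>\<in>{0<..1}. fs_closed X E \<tau> (fs_point X E e x \<alpha>)" if "fs_q_T1 X E \<tau>"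
    using fs_q_T1_imp_point_closed[OF assms that] by blast
  show "fs_q_T1 X E \<tau>"
    if "\<forall>e\<in>E. \<forall>x\<in>X. \<forall>\<alpha>\<in>{0<..1}. fs_closed X E \<tau> (fs_point X E e x \<alpha>)"
    using assms that
    by (intro points_closed_imp_fs_q_T1) (auto simp: fuzzy_soft_topological_space_def)
qed

end
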